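(* Let $M$ be an ultrametric space with a distinguished point $0$. Then the space $\mathrm{lip}^u_0(M)$ is an $M$-ideal in $\mathrm{Lip}_0(M)$.
   Context: All Banach spaces are real. A metric space $(M,d)$ is ultrametric if $d(x,y)\le\max\{d(x,z),d(z,y)\}$ for all $x,y,z\in M$. $\mathrm{Lip}_0(M)$ is the Banach space of all Lipschitz functions $f\colon M\to\mathbb{R}$ with $f(0)=0$, with norm $\|f\|=\sup\{|f(x)-f(y)|/d(x,y): x\ne y\}$. Write $B[0,r]=\{y\in M:d(0,y)\le r\}$. A function $f\in\mathrm{Lip}_0(M)$ is uniformly locally flat if for every $\varepsilon>0$ there is $\delta>0$ such that $d(x,y)<\delta$ (with $x\neq y$) implies $|f(x)-f(y)|<\varepsilon d(x,y)$. It is flat at infinity if $$\lim_{r\to\infty}\ \sup_{x\ne y,\ x\notin B[0,r]\text{ or }y\notin B[0,r]}\frac{f(x)-f(y)}{d(x,y)}=0$$ (a supremum over the empty set being $0$, so the condition is vacuous when $M$ is bounded). $\mathrm{lip}_0^u(M)$ is the set of all $f\in\mathrm{Lip}_0(M)$ that are uniformly locally flat and flat at infinity, with the norm of $\mathrm{Lip}_0(M)$. A subspace $Y$ of a Banach space $X$, with annihilator $Y^\perp\subset X^*$, is an $M$-ideal in $X$ if there is a linear projection $P$ on $X^*$ with $\ker P=Y^\perp$ and $\|x^*\|=\|Px^*\|+\|x^*-Px^*\|$ for all $x^*\in X^*$. *)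

theory Defs
  imports "HOL-Analysis.Analysis"
begin

class ultrametric_space = metric_space +
  assumes ultrametric: "dist x y \<le> max (dist x z) (dist z y)"

text \<open>A pointed metric space is a type of sort \<open>{metric_space, zero}\<close>, with \<open>0\<close> as its
  distinguished point.\<close>

typedef (overloaded) 'a lip0 =
  "{f :: 'a::{metric_space, zero} \<Rightarrow> real. f 0 = 0 \<and> (\<exists>C. C-lipschitz_on UNIV f)}"
  morphisms lip0_apply Lip0
  by (rule exI[of _ "\<lambda>_. 0"]) (auto intro: lipschitz_intros)

setup_lifting type_definition_lip0

lemma lip0_apply_zero [simp]: "lip0_apply f 0 = 0"
  using lip0_apply[of f] by simp

lemma lip0_lipschitz: "\<exists>C. C-lipschitz_on UNIV (lip0_apply f)"
  using lip0_apply[of f] by simp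

lemma lip0_eqI: "(\<And>x. lip0_apply f x = lip0_apply g x) \<Longrightarrow> f = g"
  by (metis ext lip0_apply_inject)

instantiation lip0 :: ("{metric_space, zero}") real_vector
begin

lift_definition zero_lip0 :: "'a lip0" is "\<lambda>_. 0"
  by (auto intro: lipschitz_intros)

lift_definition plus_lip0 :: "'a lip0 \<Rightarrow> 'a lip0 \<Rightarrow> 'a lip0" is "\<lambda>f g x. f x + g x"
  by (auto intro: lipschitz_on_add)

lift_definition uminus_lip0 :: "'a lip0 \<Rightarrow> 'a lip0" is "\<lambda>f x. - f x"
  by (auto intro: lipschitz_on_minus)

lift_definition minus_lip0 :: "'a lip0 \<Rightarrow> 'a lip0 \<Rightarrow> 'a lip0" is "\<lambda>f g x. f x - g x"
  by (auto intro: lipschitz_on_diff)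

lift_definition scaleR_lip0 :: "real \<Rightarrow> 'a lip0 \<Rightarrow> 'a lip0" is "\<lambda>c f x. c * f x"
  by (auto intro: lipschitz_on_cmult_real)

instance
  by standard (transfer; simp add: fun_eq_iff algebra_simps)+

end

declare zero_lip0.rep_eq [simp] plus_lip0.rep_eq [simp] uminus_lip0.rep_eq [simp]
  minus_lip0.rep_eq [simp] scaleR_lip0.rep_eq [simp]

text \<open>In the norm, and in the limit defining flatness at infinity below, \<open>insert 0\<close> only fixes the
  supremum of the empty set to be \<open>0\<close>: in both cases a nonempty supremum is nonnegative, since the
  quotients are nonnegative or form a set symmetric about \<open>0\<close>.\<close>

instantiation lip0 :: ("{metric_space, zero}") real_normed_vector
begin

definition norm_lip0 :: "'a lip0 \<Rightarrow> real" where
  "norm_lip0 f = Sup (insert 0 {\<bar>lip0_apply f x - lip0_apply f y\<bar> / dist x y | x y. x \<noteq> y})"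

definition dist_lip0 :: "'a lip0 \<Rightarrow> 'a lip0 \<Rightarrow> real" where
  "dist_lip0 f g = norm (f - g)"

definition sgn_lip0 :: "'a lip0 \<Rightarrow> 'a lip0" where
  "sgn_lip0 f = inverse (norm f) *\<^sub>R f"

definition uniformity_lip0 :: "('a lip0 \<times> 'a lip0) filter" where
  "uniformity_lip0 = (INF e\<in>{0<..}. principal {(x, y). dist x y < e})"

definition open_lip0 :: "'a lip0 set \<Rightarrow> bool" where
  "open_lip0 S = (\<forall>x\<in>S. \<forall>\<^sub>F (x', y) in uniformity. x' = x \<longrightarrow> y \<in> S)"

lemma lip0_bdd:
  "bdd_above (insert 0 {\<bar>lip0_apply f x - lip0_apply f y\<bar> / dist x y | x y. x \<noteq> y})"
proof -
  obtain C where C: "C-lipschitz_on UNIV (lip0_apply f)"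
    using lip0_lipschitz by blast
  show ?thesis
    using lipschitz_onD[OF C] lipschitz_on_nonneg[OF C]
    by (intro bdd_aboveI[of _ C]) (auto simp: dist_real_def divide_le_eq)
qed

lemma lip0_norm_nonneg: "0 \<le> norm (f :: 'a lip0)"
  unfolding norm_lip0_def by (rule cSup_upper[OF _ lip0_bdd]) simp

lemma lip0_norm_bound:
  "\<bar>lip0_apply f x - lip0_apply f y\<bar> \<le> norm f * dist x y"
proof (cases "x = y")
  case False
  have "\<bar>lip0_apply f x - lip0_apply f y\<bar> / dist x y \<le> norm f"
    unfolding norm_lip0_def by (rule cSup_upper[OF _ lip0_bdd]) (use False in auto)
  then show ?thesis
    using False by (simp add: divide_le_eq)
qed simp

lemma lip0_norm_leI:
  assumes "0 \<le> C" "\<And>x y. \<bar>lip0_apply f x - lip0_apply f y\<bar> \<le> C * dist x y"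
  shows "norm f \<le> C"
  unfolding norm_lip0_def
  by (rule cSup_least) (use assms in \<open>auto simp: divide_le_eq\<close>)

lemma lip0_norm_scaleR_le: "norm (c *\<^sub>R f) \<le> \<bar>c\<bar> * norm (f :: 'a lip0)"
proof (rule lip0_norm_leI)
  fix x y
  have "\<bar>c * lip0_apply f x - c * lip0_apply f y\<bar> = \<bar>c\<bar> * \<bar>lip0_apply f x - lip0_apply f y\<bar>"
    by (simp add: abs_mult flip: right_diff_distrib)
  also have "\<dots> \<le> \<bar>c\<bar> * (norm f * dist x y)"
    by (intro mult_left_mono lip0_norm_bound) simp
  finally show "\<bar>lip0_apply (c *\<^sub>R f) x - lip0_apply (c *\<^sub>R f) y\<bar> \<le> \<bar>c\<bar> * norm f * dist x y"
    by (simp add: mult.assoc)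
qed (simp add: lip0_norm_nonneg)

instance
proof
  fix f g :: "'a lip0" and c :: real
  show "norm f = 0 \<longleftrightarrow> f = 0"
  proof
    assume "norm f = 0"
    then show "f = 0"
      by (intro lip0_eqI) (use lip0_norm_bound[of f _ 0] in simp)
  next
    assume "f = 0"
    then show "norm f = 0"
      by (intro antisym lip0_norm_leI lip0_norm_nonneg) auto
  qed
  show "norm (f + g) \<le> norm f + norm g"
  proof (rule lip0_norm_leI)
    fix x y
    show "\<bar>lip0_apply (f + g) x - lip0_apply (f + g) y\<bar> \<le> (norm f + norm g) * dist x y"
      using lip0_norm_bound[of f x y] lip0_norm_bound[of g x y]
      by (simp add: distrib_right)
  qed (simp add: lip0_norm_nonneg)
  show "norm (c *\<^sub>R f) = \<bar>c\<bar> * norm f"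
  proof (rule antisym[OF lip0_norm_scaleR_le], cases "c = 0")
    case True
    then show "\<bar>c\<bar> * norm f \<le> norm (c *\<^sub>R f)"
      by (simp add: lip0_norm_nonneg)
  next
    case False
    have "norm f \<le> \<bar>inverse c\<bar> * norm (c *\<^sub>R f)"
      using lip0_norm_scaleR_le[of "inverse c" "c *\<^sub>R f"] False by simp
    then show "\<bar>c\<bar> * norm f \<le> norm (c *\<^sub>R f)"
      using False by (simp add: field_simps)
  qed
qed (rule dist_lip0_def sgn_lip0_def uniformity_lip0_def open_lip0_def)+

end

instance lip0 :: ("{metric_space, zero}") banach
proof
  fix F :: "nat \<Rightarrow> 'a lip0"
  assume "Cauchy F"
  then have cau: "\<exists>N. \<forall>m\<ge>N. \<forall>n\<ge>N. norm (F m - F n) < e" if "e > 0" for e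
    using that by (simp add: Cauchy_iff)
  have "Cauchy (\<lambda>n. lip0_apply (F n) x)" for x
  proof (rule CauchyI)
    fix e :: real
    assume "e > 0"
    then have "0 < e / (1 + dist x 0)"
      by (simp add: add_pos_nonneg)
    then obtain N where N: "\<And>m n. m \<ge> N \<Longrightarrow> n \<ge> N \<Longrightarrow> norm (F m - F n) < e / (1 + dist x 0)"
      using cau by blast
    have "norm (lip0_apply (F m) x - lip0_apply (F n) x) < e" if "m \<ge> N" "n \<ge> N" for m n
    proof -
      have "norm (lip0_apply (F m) x - lip0_apply (F n) x) \<le> norm (F m - F n) * dist x 0"
        using lip0_norm_bound[of "F m - F n" x 0] by simp
      also have "\<dots> \<le> norm (F m - F n) * (1 + dist x 0)"
        by (intro mult_left_mono) auto
      also have "\<dots> < e"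
        using N[OF that] by (simp add: less_divide_eq add_pos_nonneg)
      finally show ?thesis .
    qed
    then show "\<exists>N. \<forall>m\<ge>N. \<forall>n\<ge>N. norm (lip0_apply (F m) x - lip0_apply (F n) x) < e"
      by blast
  qed
  then have conv: "convergent (\<lambda>n. lip0_apply (F n) x)" for x
    by (rule Cauchy_convergent)
  define g where "g = (\<lambda>x. lim (\<lambda>n. lip0_apply (F n) x))"
  have g: "(\<lambda>n. lip0_apply (F n) x) \<longlonglongrightarrow> g x" for x
    using conv[of x] unfolding g_def convergent_LIMSEQ_iff .
  have lim: "\<bar>(lip0_apply (F m) x - g x) - (lip0_apply (F m) y - g y)\<bar> \<le> e * dist x y"
    if N: "\<And>n. n \<ge> N \<Longrightarrow> norm (F m - F n) < e" for e m N x y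
  proof (rule tendsto_upperbound)
    show "(\<lambda>n. \<bar>(lip0_apply (F m) x - lip0_apply (F n) x)
             - (lip0_apply (F m) y - lip0_apply (F n) y)\<bar>)
          \<longlonglongrightarrow> \<bar>(lip0_apply (F m) x - g x) - (lip0_apply (F m) y - g y)\<bar>"
      by (intro tendsto_intros g)
    show "\<forall>\<^sub>F n in sequentially. \<bar>(lip0_apply (F m) x - lip0_apply (F n) x)
             - (lip0_apply (F m) y - lip0_apply (F n) y)\<bar> \<le> e * dist x y"
    proof (rule eventually_sequentiallyI[of N])
      fix n
      assume "N \<le> n"
      have "\<bar>(lip0_apply (F m) x - lip0_apply (F n) x)
             - (lip0_apply (F m) y - lip0_apply (F n) y)\<bar> \<le> norm (F m - F n) * dist x y"
        using lip0_norm_bound[of "F m - F n" x y] by simp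
      also have "\<dots> \<le> e * dist x y"
        using N[OF \<open>N \<le> n\<close>] by (intro mult_right_mono) auto
      finally show "\<bar>(lip0_apply (F m) x - lip0_apply (F n) x)
             - (lip0_apply (F m) y - lip0_apply (F n) y)\<bar> \<le> e * dist x y" .
    qed
  qed simp
  have "\<exists>C. C-lipschitz_on UNIV g"
  proof -
    obtain N where N: "\<And>m n. m \<ge> N \<Longrightarrow> n \<ge> N \<Longrightarrow> norm (F m - F n) < 1"
      using cau[of 1] by auto
    have "(1 + norm (F N))-lipschitz_on UNIV g"
    proof (rule lipschitz_onI)
      fix x y
      have "\<bar>(lip0_apply (F N) x - g x) - (lip0_apply (F N) y - g y)\<bar> \<le> 1 * dist x y"
        by (rule lim) (rule N[OF order_refl])
      then show "dist (g x) (g y) \<le> (1 + norm (F N)) * dist x y"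
        using lip0_norm_bound[of "F N" x y]
        by (simp add: dist_real_def distrib_right)
    qed simp
    then show ?thesis ..
  qed
  moreover have "g 0 = 0"
    using g[of 0] by (simp add: LIMSEQ_const_iff)
  ultimately have G: "lip0_apply (Lip0 g) = g"
    by (simp add: Lip0_inverse)
  have "F \<longlonglongrightarrow> Lip0 g"
  proof (rule LIMSEQ_I)
    fix e :: real
    assume "e > 0"
    then obtain N where N: "\<And>m n. m \<ge> N \<Longrightarrow> n \<ge> N \<Longrightarrow> norm (F m - F n) < e / 2"
      using cau[of "e / 2"] by auto
    have "norm (F n - Lip0 g) \<le> e / 2" if "n \<ge> N" for n
    proof (rule lip0_norm_leI)
      fix x y
      have "\<bar>(lip0_apply (F n) x - g x) - (lip0_apply (F n) y - g y)\<bar> \<le> e / 2 * dist x y"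
        by (rule lim) (rule N[OF that])
      then show "\<bar>lip0_apply (F n - Lip0 g) x - lip0_apply (F n - Lip0 g) y\<bar> \<le> e / 2 * dist x y"
        by (simp add: G)
    qed (use \<open>e > 0\<close> in simp)
    then show "\<exists>N. \<forall>n\<ge>N. norm (F n - Lip0 g) < e"
      using \<open>e > 0\<close> by (intro exI[of _ N]) force
  qed
  then show "convergent F"
    by (auto simp: convergent_def)
qed

definition uniformly_locally_flat :: "('a::metric_space \<Rightarrow> real) \<Rightarrow> bool" where
  "uniformly_locally_flat f \<longleftrightarrow>
     (\<forall>\<epsilon>>0. \<exists>\<delta>>0. \<forall>x y. x \<noteq> y \<and> dist x y < \<delta> \<longrightarrow> \<bar>f x - f y\<bar> < \<epsilon> * dist x y)"

definition flat_at_infinity :: "('a::{metric_space, zero} \<Rightarrow> real) \<Rightarrow> bool" where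
  "flat_at_infinity f \<longleftrightarrow>
     ((\<lambda>r. Sup (insert 0 {(f x - f y) / dist x y | x y.
                  x \<noteq> y \<and> (x \<notin> cball 0 r \<or> y \<notin> cball 0 r)})) \<longlongrightarrow> 0) at_top"

definition lip0_u :: "'a::{metric_space, zero} lip0 set" where
  "lip0_u = {f. uniformly_locally_flat (lip0_apply f) \<and> flat_at_infinity (lip0_apply f)}"

definition annihilator :: "'b::real_normed_vector set \<Rightarrow> ('b \<Rightarrow>\<^sub>L real) set" where
  "annihilator Y = {\<phi>. \<forall>y\<in>Y. blinfun_apply \<phi> y = 0}"

definition M_ideal :: "'b::banach set \<Rightarrow> bool" where
  "M_ideal Y \<longleftrightarrow> subspace Y \<and>
     (\<exists>P :: ('b \<Rightarrow>\<^sub>L real) \<Rightarrow> ('b \<Rightarrow>\<^sub>L real).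
        linear P \<and> P \<circ> P = P \<and> {\<phi>. P \<phi> = 0} = annihilator Y \<and>
        (\<forall>\<phi>. norm \<phi> = norm (P \<phi>) + norm (\<phi> - P \<phi>)))"

end

theory Submission
  imports Defs
begin

text \<open>
  An \<open>M\<close>-ideal is recognised by approximate projections onto it: linear operators \<open>K n\<close> with values
  in \<open>Y\<close> that converge to the identity on \<open>Y\<close> and satisfy
  \<open>norm (K n f + (g - K n g)) \<le> (1 + e n) * max (norm f) (norm g)\<close> with \<open>e n\<close> tending to \<open>0\<close>. The
  projection of the dual space is then the limit of \<open>\<phi> \<mapsto> \<phi> \<circ> K n\<close> along an ultrafilter, and the norm
  condition becomes the additivity of the dual norms (\<open>M_ideal_if_approximate_projections\<close>).

  On an ultrametric space there are good operators with values in the flat functions. The balls of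
  radius \<open>s\<close> partition the space; replacing each point by a chosen point of its ball and cutting the
  function off outside the ball of radius \<open>R\<close> about \<open>0\<close> does not increase the Lipschitz constant,
  because at distances larger than \<open>s\<close> the choice of the points does not enlarge distances, and points
  separated by the boundary of a ball about \<open>0\<close> are at least as far apart as the inner one is from
  \<open>0\<close>. The result \<open>discretize s R f\<close> is flat, and it is close to \<open>f\<close> when \<open>f\<close> is flat, \<open>s\<close> is small
  and \<open>R\<close> is large (\<open>discretize_in_lip0_u\<close>, \<open>discretize_approximates\<close>).

  For a fixed pair of points at distance \<open>t\<close>, this operator nearly preserves the difference of
  function values, or nearly annihilates it, the same alternative holding for all functions, unless
  \<open>t\<close> is slightly larger than \<open>s\<close> or \<open>R\<close> (\<open>discretize_keeps_or_kills\<close>). In the nonexceptional case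
  the difference of \<open>K f + (g - K g)\<close> is nearly that of \<open>f\<close> or that of \<open>g\<close>, which is the estimate
  wanted. The exceptional case is averaged away: in a mean over \<open>N\<close> widely separated pairs of scales,
  each pair of points is exceptional for at most one of them, at a cost of order \<open>1 / N\<close>
  (\<open>at_most_one_scale_in_gap\<close>, \<open>multiscale_glue\<close>).
\<close>

section \<open>Limits along ultrafilters\<close>

text \<open>The filters finer than \<open>F\<close> other than \<open>bot\<close> satisfy the hypothesis of Zorn's lemma: the
  infimum of a chain of them consists of the sets that belong to some member, so that it does not
  contain the empty set. A minimal one is an ultrafilter.\<close>

lemma ultrafilter_exists:
  fixes F :: "'b filter"
  assumes "F \<noteq> bot"
  obtains U where "U \<le> F" "U \<noteq> bot" "\<And>G. G \<le> U \<Longrightarrow> G \<noteq> bot \<Longrightarrow> G = U"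
proof -
  let ?A = "{G. G \<noteq> bot \<and> G \<le> F}"
  have "\<exists>m\<in>?A. \<forall>a\<in>?A. m \<ge> a \<longrightarrow> a = m"
  proof (rule predicate_Zorn)
    show "partial_order_on ?A (relation_of (\<ge>) ?A)"
      by (rule partial_order_on_relation_ofI) auto
    fix C
    assume C: "C \<in> Chains (relation_of (\<ge>) ?A)"
    then have mem: "\<And>G. G \<in> C \<Longrightarrow> G \<noteq> bot \<and> G \<le> F"
      and lin: "\<And>G H. G \<in> C \<Longrightarrow> H \<in> C \<Longrightarrow> G \<le> H \<or> H \<le> G"
      by (auto simp: Chains_def relation_of_def)
    show "\<exists>u\<in>?A. \<forall>a\<in>C. u \<le> a"
    proof (cases "C = {}")
      case True
      then show ?thesis
        using assms by auto
    next
      case False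
      have "\<not> eventually (\<lambda>_. False) (Inf C)"
      proof (subst eventually_Inf_base[OF False])
        show "\<exists>H\<in>C. H \<le> inf G G'" if "G \<in> C" "G' \<in> C" for G G'
          using lin[OF that] that by (metis inf.absorb1 inf.absorb2 order_refl)
        show "\<not> (\<exists>G\<in>C. eventually (\<lambda>_. False) G)"
          using mem by (auto simp: trivial_limit_def)
      qed
      moreover have "Inf C \<le> F"
        using False mem by (meson Inf_lower2 ex_in_conv)
      ultimately show ?thesis
        by (intro bexI[of _ "Inf C"]) (auto simp: trivial_limit_def Inf_lower)
    qed
  qed
  then show ?thesis
    using that by (metis (mono_tags, lifting) mem_Collect_eq order_trans)
qed

text \<open>Compactness of a closed interval gives a cluster point \<open>l\<close> of \<open>X\<close> along \<open>U\<close>. Refining \<open>U\<close>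
  by the condition that \<open>X\<close> be close to \<open>l\<close> does not change \<open>U\<close>, so \<open>l\<close> is a limit.\<close>

lemma bounded_tendsto_ultrafilter:
  fixes X :: "'b \<Rightarrow> real"
  assumes "U \<noteq> bot" and fine: "\<And>G. G \<le> U \<Longrightarrow> G \<noteq> bot \<Longrightarrow> G = U"
    and "\<forall>\<^sub>F n in U. \<bar>X n\<bar> \<le> C"
  shows "\<exists>l. (X \<longlongrightarrow> l) U"
proof -
  have "\<forall>\<^sub>F x in filtermap X U. x \<in> cball 0 C"
    using assms(3) by (simp add: eventually_filtermap)
  moreover have "filtermap X U \<noteq> bot"
    using assms(1) by (simp add: filtermap_bot_iff)
  ultimately obtain l where l: "inf (nhds l) (filtermap X U) \<noteq> bot"
    using compact_cball[of "0::real" C] unfolding compact_filter by blast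
  have "inf (filtercomap X (nhds l)) U \<noteq> bot"
  proof
    assume "inf (filtercomap X (nhds l)) U = bot"
    then obtain P Q where "eventually P (nhds l)" "eventually Q U"
      and *: "\<And>n. P (X n) \<Longrightarrow> Q n \<Longrightarrow> False"
      unfolding trivial_limit_def eventually_inf eventually_filtercomap by metis
    moreover from this(2) have "\<forall>\<^sub>F x in filtermap X U. \<not> P x"
      unfolding eventually_filtermap by (rule eventually_mono) (use * in blast)
    ultimately have "eventually (\<lambda>_. False) (inf (nhds l) (filtermap X U))"
      unfolding eventually_inf by blast
    with l show False
      by (simp add: trivial_limit_def)
  qed
  then have "inf (filtercomap X (nhds l)) U = U"
    by (intro fine) auto
  then have "U \<le> filtercomap X (nhds l)"
    by (metis inf.cobounded1)
  then show ?thesis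
    unfolding filterlim_iff_le_filtercomap by blast
qed

section \<open>A criterion for M-ideals\<close>

text \<open>The unit ball is symmetric, so one-sided bounds on it are enough.\<close>

lemma norm_blinfun_le_if_unit_ball:
  fixes \<psi> :: "'b::real_normed_vector \<Rightarrow>\<^sub>L real"
  assumes "\<And>f. norm f \<le> 1 \<Longrightarrow> blinfun_apply \<psi> f \<le> c"
  shows "norm \<psi> \<le> c"
proof (rule norm_blinfun_bound)
  show "0 \<le> c"
    using assms[of 0] by (simp add: blinfun.zero_right)
  fix f :: 'b
  show "norm (blinfun_apply \<psi> f) \<le> c * norm f"
  proof (cases "f = 0")
    case False
    define u where "u = inverse (norm f) *\<^sub>R f"
    have "norm u = 1" and f: "f = norm f *\<^sub>R u"
      using False by (auto simp: u_def)
    then have "\<bar>blinfun_apply \<psi> u\<bar> \<le> c"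
      using assms[of u] assms[of "- u"] by (auto simp: blinfun.minus_right)
    then have "norm f * \<bar>blinfun_apply \<psi> u\<bar> \<le> norm f * c"
      by (rule mult_left_mono) simp
    moreover have "blinfun_apply \<psi> f = norm f * blinfun_apply \<psi> u"
      by (subst f) (simp add: blinfun.scaleR_right)
    ultimately show ?thesis
      by (simp add: abs_mult mult.commute)
  qed (simp add: blinfun.zero_right)
qed

text \<open>The operators \<open>K n\<close> are approximate projections onto \<open>Y\<close> that split the space like
  an \<open>\<ell>\<^sub>\<infinity>\<close> sum, and \<open>P \<phi> f\<close> is the limit of \<open>\<phi> (K n f)\<close>. A single ultrafilter serves all
  \<open>\<phi>\<close> and \<open>f\<close>, so that \<open>P\<close> is linear. Since \<open>P \<phi>\<close> and \<open>\<phi>\<close> agree on \<open>Y\<close> and \<open>P \<phi>\<close> depends only on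
  the restriction of \<open>\<phi>\<close> to \<open>Y\<close>, the map \<open>P\<close> is a projection with kernel the annihilator. Finally
  \<open>P \<phi> f + (\<phi> - P \<phi>) g\<close> is the limit of \<open>\<phi> (K n f + (g - K n g))\<close>; suprema over \<open>f\<close> and \<open>g\<close> in the
  unit ball turn the last hypothesis into the additivity of the norm.\<close>

lemma M_ideal_if_approximate_projections:
  fixes Y :: "'b::banach set" and K :: "nat \<Rightarrow> 'b \<Rightarrow> 'b"
  assumes Y: "subspace Y"
    and lin: "\<And>n. linear (K n)"
    and range: "\<And>n f. K n f \<in> Y"
    and conv: "\<And>y. y \<in> Y \<Longrightarrow> (\<lambda>n. K n y) \<longlonglongrightarrow> y"
    and e: "e \<longlonglongrightarrow> 0"
    and glue: "\<And>n f g. norm (K n f + (g - K n g)) \<le> (1 + e n) * max (norm f) (norm g)"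
  shows "M_ideal Y"
proof -
  obtain U :: "nat filter" where U: "U \<le> sequentially" "U \<noteq> bot"
    and fine: "\<And>G. G \<le> U \<Longrightarrow> G \<noteq> bot \<Longrightarrow> G = U"
    using ultrafilter_exists[OF sequentially_bot] by metis
  have eU: "(e \<longlongrightarrow> 0) U"
    using e U(1) tendsto_mono by blast
  have K_bound: "norm (K n f) \<le> (1 + e n) * norm f" for n f
    using glue[of n f 0] by (simp add: linear_0[OF lin] max_absorb1)
  have limit_exists: "\<exists>l. ((\<lambda>n. blinfun_apply \<phi> (K n f)) \<longlongrightarrow> l) U" for \<phi> :: "'b \<Rightarrow>\<^sub>L real" and f
  proof -
    have "\<forall>\<^sub>F n in U. e n < 1"
      using eU order_tendstoD(2) zero_less_one by blast
    then have "\<forall>\<^sub>F n in U. \<bar>blinfun_apply \<phi> (K n f)\<bar> \<le> norm \<phi> * (2 * norm f)"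
    proof eventually_elim
      case (elim n)
      have "norm (K n f) \<le> 2 * norm f"
        by (rule order_trans[OF K_bound mult_right_mono]) (use elim in auto)
      then have "norm \<phi> * norm (K n f) \<le> norm \<phi> * (2 * norm f)"
        by (rule mult_left_mono) simp
      then show ?case
        using norm_blinfun[of \<phi> "K n f"] by simp
    qed
    then show ?thesis
      by (intro bounded_tendsto_ultrafilter[OF U(2)]) (rule fine)
  qed
  define L where "L \<phi> f = (SOME l. ((\<lambda>n. blinfun_apply \<phi> (K n f)) \<longlongrightarrow> l) U)"
    for \<phi> :: "'b \<Rightarrow>\<^sub>L real" and f
  have L: "((\<lambda>n. blinfun_apply \<phi> (K n f)) \<longlongrightarrow> L \<phi> f) U" for \<phi> f
    unfolding L_def by (rule someI_ex[OF limit_exists])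
  have L_eqI: "L \<phi> f = l" if "((\<lambda>n. blinfun_apply \<phi> (K n f)) \<longlongrightarrow> l) U" for \<phi> f l
    using tendsto_unique[OF U(2) L that] .
  have L_bound: "\<bar>L \<phi> f\<bar> \<le> norm \<phi> * norm f" for \<phi> f
  proof (rule tendsto_le[OF U(2)])
    show "((\<lambda>n. \<bar>blinfun_apply \<phi> (K n f)\<bar>) \<longlongrightarrow> \<bar>L \<phi> f\<bar>) U"
      by (intro tendsto_intros L)
    show "((\<lambda>n. norm \<phi> * ((1 + e n) * norm f)) \<longlongrightarrow> norm \<phi> * norm f) U"
      by (rule tendsto_eq_intros eU refl | simp)+
    have "\<bar>blinfun_apply \<phi> (K n f)\<bar> \<le> norm \<phi> * ((1 + e n) * norm f)" for n
      using norm_blinfun[of \<phi> "K n f"] mult_left_mono[OF K_bound[of n f], of "norm \<phi>"] by simp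
    then show "\<forall>\<^sub>F n in U. \<bar>blinfun_apply \<phi> (K n f)\<bar> \<le> norm \<phi> * ((1 + e n) * norm f)"
      by simp
  qed
  define P where "P \<phi> = Blinfun (L \<phi>)" for \<phi>
  have "bounded_linear (L \<phi>)" for \<phi>
  proof (rule bounded_linear_intro[where K = "norm \<phi>"])
    show "L \<phi> (f + g) = L \<phi> f + L \<phi> g" for f g
      by (rule L_eqI) (simp add: linear_add[OF lin] blinfun.add_right tendsto_add L)
    show "L \<phi> (c *\<^sub>R f) = c *\<^sub>R L \<phi> f" for c f
      by (rule L_eqI) (simp add: linear_scale[OF lin] blinfun.scaleR_right tendsto_mult_left L)
    show "norm (L \<phi> f) \<le> norm f * norm \<phi>" for f
      using L_bound[of \<phi> f] by (simp add: mult.commute)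
  qed
  then have P: "blinfun_apply (P \<phi>) = L \<phi>" for \<phi>
    unfolding P_def by (rule bounded_linear_Blinfun_apply)
  have P_eq: "blinfun_apply (P \<phi>) y = blinfun_apply \<phi> y" if "y \<in> Y" for \<phi> y
    unfolding P
    by (rule L_eqI) (intro tendsto_intros tendsto_mono[OF U(1) conv[OF that]])
  have P_zero: "P \<phi> = 0 \<longleftrightarrow> \<phi> \<in> annihilator Y" for \<phi>
  proof
    assume "P \<phi> = 0"
    then show "\<phi> \<in> annihilator Y"
      using P_eq[of _ \<phi>] by (simp add: annihilator_def)
  next
    assume "\<phi> \<in> annihilator Y"
    then have "L \<phi> f = 0" for f
      by (intro L_eqI) (simp add: annihilator_def range)
    then show "P \<phi> = 0"
      by (intro blinfun_eqI) (simp add: P)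
  qed
  have P_linear: "linear P"
  proof (rule linearI)
    show "P (\<phi> + \<psi>) = P \<phi> + P \<psi>" for \<phi> \<psi>
      by (rule blinfun_eqI) (simp add: P blinfun.add_left L_eqI tendsto_add L)
    show "P (c *\<^sub>R \<phi>) = c *\<^sub>R P \<phi>" for c \<phi>
      by (rule blinfun_eqI) (simp add: P blinfun.scaleR_left L_eqI tendsto_mult_left L)
  qed
  have "P (P \<phi>) = P \<phi>" for \<phi>
  proof -
    have "P \<phi> - \<phi> \<in> annihilator Y"
      by (simp add: annihilator_def P_eq blinfun.diff_left)
    then show ?thesis
      using P_zero[of "P \<phi> - \<phi>"] linear_diff[OF P_linear] by simp
  qed
  moreover have "norm \<phi> = norm (P \<phi>) + norm (\<phi> - P \<phi>)" for \<phi>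
  proof (rule antisym)
    show "norm \<phi> \<le> norm (P \<phi>) + norm (\<phi> - P \<phi>)"
      using norm_triangle_ineq[of "P \<phi>" "\<phi> - P \<phi>"] by simp
    \<comment> \<open>The absolute value makes the bound monotone in \<open>max (norm f) (norm g)\<close> for every \<open>n\<close>.\<close>
    have split_bound: "blinfun_apply (P \<phi>) f + blinfun_apply (\<phi> - P \<phi>) g \<le> norm \<phi>"
      if "norm f \<le> 1" "norm g \<le> 1" for f g
    proof (rule tendsto_le[OF U(2)])
      show "((\<lambda>n. blinfun_apply \<phi> (K n f + (g - K n g))) \<longlongrightarrow>
              blinfun_apply (P \<phi>) f + blinfun_apply (\<phi> - P \<phi>) g) U"
        by (simp add: blinfun.add_right blinfun.diff_right blinfun.diff_left P)
          (intro tendsto_intros L)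
      show "((\<lambda>n. norm \<phi> * \<bar>1 + e n\<bar>) \<longlongrightarrow> norm \<phi>) U"
        by (rule tendsto_eq_intros eU refl | simp)+
      have "blinfun_apply \<phi> (K n f + (g - K n g)) \<le> norm \<phi> * \<bar>1 + e n\<bar>" for n
      proof -
        have "norm (K n f + (g - K n g)) \<le> \<bar>1 + e n\<bar> * max (norm f) (norm g)"
          using glue[of n f g] by (rule order_trans) (intro mult_right_mono, auto simp: le_max_iff_disj)
        also have "\<dots> \<le> \<bar>1 + e n\<bar>"
          using that by (intro mult_left_le) auto
        finally have "norm \<phi> * norm (K n f + (g - K n g)) \<le> norm \<phi> * \<bar>1 + e n\<bar>"
          by (rule mult_left_mono) simp
        then show ?thesis
          using norm_blinfun[of \<phi> "K n f + (g - K n g)"] by simp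
      qed
      then show "\<forall>\<^sub>F n in U. blinfun_apply \<phi> (K n f + (g - K n g)) \<le> norm \<phi> * \<bar>1 + e n\<bar>"
        by simp
    qed
    have "norm (P \<phi>) \<le> norm \<phi> - blinfun_apply (\<phi> - P \<phi>) g" if "norm g \<le> 1" for g
      using split_bound[OF _ that] by (intro norm_blinfun_le_if_unit_ball) (simp add: le_diff_eq)
    then have "norm (\<phi> - P \<phi>) \<le> norm \<phi> - norm (P \<phi>)"
      by (intro norm_blinfun_le_if_unit_ball) (simp add: le_diff_eq add.commute)
    then show "norm (P \<phi>) + norm (\<phi> - P \<phi>) \<le> norm \<phi>"
      by simp
  qed
  moreover have "P \<circ> P = P"
    using calculation(1) by (simp add: fun_eq_iff)
  moreover have "{\<phi>. P \<phi> = 0} = annihilator Y"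
    using P_zero by blast
  ultimately show ?thesis
    unfolding M_ideal_def using Y P_linear by blast
qed

section \<open>Choosing a point in each ball of an ultrametric space\<close>

lemma ultrametric_le:
  fixes x y z :: "'a::ultrametric_space"
  assumes "dist x z \<le> r" "dist z y \<le> r"
  shows "dist x y \<le> r"
  using ultrametric[of x y z] assms by linarith

text \<open>In an ultrametric space, the distance from the centre \<open>z\<close> of a ball to a point \<open>y\<close> outside is
  at most the distance from any point of the ball to \<open>y\<close>. This is why extending by zero from a ball
  about \<open>0\<close> does not increase a Lipschitz constant.\<close>

lemma dist_across_ball:
  fixes z :: "'a::ultrametric_space"
  assumes "dist z x \<le> R" "R < dist z y"
  shows "dist z y \<le> dist x y"
  using ultrametric[of z y x] assms by linarith

text \<open>The closed balls of radius \<open>s\<close> partition the space, and this map picks one point of each: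
  the predicate under \<open>SOME\<close> is the same for all \<open>x\<close> in one ball. The
  ball of \<open>0\<close> is represented by \<open>0\<close> so that composition with the map preserves vanishing at \<open>0\<close>.\<close>

definition ball_point :: "real \<Rightarrow> 'a::{ultrametric_space, zero} \<Rightarrow> 'a" where
  "ball_point s x = (if dist 0 x \<le> s then 0 else SOME y. dist x y \<le> s)"

lemma dist_ball_point:
  assumes "0 \<le> s"
  shows "dist x (ball_point s x) \<le> s"
proof (cases "dist 0 x \<le> s")
  case True
  then show ?thesis
    by (simp add: ball_point_def dist_commute)
next
  case False
  have "dist x (SOME y. dist x y \<le> s) \<le> s"
    by (rule someI[of _ x]) (use assms in simp)
  with False show ?thesis
    by (simp add: ball_point_def)
qed

lemma ball_point_cong:
  assumes "dist x y \<le> s"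
  shows "ball_point s x = ball_point s y"
proof -
  have "dist x z \<le> s \<longleftrightarrow> dist y z \<le> s" for z
    using ultrametric_le[of x y s z] ultrametric_le[of y x s z] assms by (auto simp: dist_commute)
  moreover from this have "dist 0 x \<le> s \<longleftrightarrow> dist 0 y \<le> s"
    by (metis dist_commute)
  ultimately show ?thesis
    by (simp add: ball_point_def)
qed

lemma ball_point_0 [simp]: "0 \<le> s \<Longrightarrow> ball_point s 0 = 0"
  by (simp add: ball_point_def)

text \<open>Two points at distance at most \<open>s\<close> have the same image; at a larger distance, moving each of
  them by at most \<open>s\<close> does not increase the distance.\<close>

lemma dist_ball_point_le:
  assumes "0 \<le> s"
  shows "dist (ball_point s x) (ball_point s y) \<le> dist x y"
proof (cases "dist x y \<le> s")
  case True
  then show ?thesis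
    by (simp add: ball_point_cong)
next
  case False
  then have "dist (ball_point s x) x \<le> dist x y" "dist y (ball_point s y) \<le> dist x y"
    using dist_ball_point[OF assms, of x] dist_ball_point[OF assms, of y]
    by (auto simp: dist_commute)
  then show ?thesis
    using ultrametric_le[of "ball_point s x" x "dist x y" y]
      ultrametric_le[of "ball_point s x" y "dist x y" "ball_point s y"] by simp
qed

section \<open>Discretization of Lipschitz functions\<close>

definition discretize :: "real \<Rightarrow> real \<Rightarrow> 'a::{ultrametric_space, zero} lip0 \<Rightarrow> 'a lip0" where
  "discretize s R f = Lip0 (\<lambda>x. if dist 0 x \<le> R then lip0_apply f (ball_point s x) else 0)"

lemma lip0_apply_le: "\<bar>lip0_apply f x\<bar> \<le> norm f * dist 0 x"
  using lip0_norm_bound[of f x 0] by (simp add: dist_commute)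

lemma abs_apply_ball_point_le:
  assumes "0 \<le> s"
  shows "\<bar>lip0_apply f (ball_point s x)\<bar> \<le> norm f * dist 0 x"
proof -
  have "\<bar>lip0_apply f (ball_point s x)\<bar> \<le> norm f * dist 0 (ball_point s x)"
    by (rule lip0_apply_le)
  also have "\<dots> \<le> norm f * dist 0 x"
    using dist_ball_point_le[OF assms, of 0 x] assms by (intro mult_left_mono) auto
  finally show ?thesis .
qed

lemma lip0_ball_point_diff_le:
  assumes "0 \<le> s"
  shows "\<bar>lip0_apply f (ball_point s x) - lip0_apply f (ball_point s y)\<bar> \<le> norm f * dist x y"
  using lip0_norm_bound[of f "ball_point s x" "ball_point s y"]
    mult_left_mono[OF dist_ball_point_le[OF assms, of x y], of "norm f"] by simp

text \<open>Across the boundary of the ball of radius \<open>R\<close>, the value at the inner point \<open>x\<close> is at most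
  \<open>norm f * dist 0 x\<close>, and \<open>dist_across_ball\<close> compares \<open>dist 0 x\<close> with the distance of the two
  points.\<close>

lemma cutoff_diff_le:
  fixes f :: "'a::{ultrametric_space, zero} lip0" and R :: real
  assumes "0 \<le> s"
  defines "h \<equiv> \<lambda>x. if dist 0 x \<le> R then lip0_apply f (ball_point s x) else 0"
  shows "\<bar>h x - h y\<bar> \<le> norm f * dist x y"
proof -
  have one_sided: "\<bar>h x - h y\<bar> \<le> norm f * dist x y" if "dist 0 x \<le> dist 0 y" for x y
  proof (cases "dist 0 x \<le> R \<and> R < dist 0 y")
    case True
    have "\<bar>lip0_apply f (ball_point s x)\<bar> \<le> norm f * dist 0 x"
      by (rule abs_apply_ball_point_le[OF assms(1)])
    also have "\<dots> \<le> norm f * dist x y"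
      using dist_across_ball[of 0 x R y] True by (intro mult_left_mono) auto
    finally show ?thesis
      using True by (simp add: h_def)
  next
    case False
    then show ?thesis
      using that lip0_ball_point_diff_le[OF assms(1)] by (auto simp: h_def)
  qed
  show ?thesis
    using one_sided[of x y] one_sided[of y x] linear[of "dist 0 x" "dist 0 y"]
    by (auto simp only: dist_commute[of y x] abs_minus_commute[of "h y"])
qed

lemma discretize_apply:
  assumes "0 \<le> s"
  shows "lip0_apply (discretize s R f) x =
    (if dist 0 x \<le> R then lip0_apply f (ball_point s x) else 0)"
proof -
  let ?h = "\<lambda>x. if dist 0 x \<le> R then lip0_apply f (ball_point s x) else 0"
  have "(norm f)-lipschitz_on UNIV ?h"
    by (rule lipschitz_onI) (simp_all only: dist_real_def cutoff_diff_le[OF assms] norm_ge_zero)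
  moreover have "?h 0 = 0"
    using assms by simp
  ultimately show ?thesis
    unfolding discretize_def by (subst Lip0_inverse) auto
qed

lemma linear_discretize:
  assumes "0 \<le> s"
  shows "linear (discretize s R)"
  by (intro linearI lip0_eqI) (simp_all add: discretize_apply[OF assms])

lemma discretize_diff_le:
  assumes "0 \<le> s"
  shows "\<bar>lip0_apply (discretize s R f) x - lip0_apply (discretize s R f) y\<bar> \<le> norm f * dist x y"
  using cutoff_diff_le[OF assms, where R = R] by (simp only: discretize_apply[OF assms])

section \<open>The subspace of flat functions\<close>

text \<open>Exchanging \<open>x\<close> and \<open>y\<close> changes the sign of the quotient. Hence bounding the supremum bounds the
  absolute values, and the far point of the pair may be taken to be \<open>x\<close>.\<close>

lemma flat_at_infinity_iff:
  fixes f :: "'a::{metric_space, zero} lip0"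
  shows "flat_at_infinity (lip0_apply f) \<longleftrightarrow>
    (\<forall>\<epsilon>>0. \<exists>r. \<forall>x y. r < dist 0 x \<longrightarrow> \<bar>lip0_apply f x - lip0_apply f y\<bar> \<le> \<epsilon> * dist x y)"
    (is "?L \<longleftrightarrow> ?R")
proof -
  define A where "A r = insert 0 {(lip0_apply f x - lip0_apply f y) / dist x y | x y.
                  x \<noteq> y \<and> (x \<notin> cball 0 r \<or> y \<notin> cball 0 r)}" for r
  have flat: "?L \<longleftrightarrow> ((\<lambda>r. Sup (A r)) \<longlongrightarrow> 0) at_top"
    by (simp add: flat_at_infinity_def A_def)
  have bdd: "bdd_above (A r)" for r
  proof (rule bdd_aboveI[of _ "norm f"])
    fix q
    assume "q \<in> A r"
    then consider "q = 0" | x y where "x \<noteq> y" "q = (lip0_apply f x - lip0_apply f y) / dist x y"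
      by (auto simp: A_def)
    then show "q \<le> norm f"
    proof cases
      case 2
      then show ?thesis
        using lip0_norm_bound[of f x y] by (simp add: divide_le_eq)
    qed simp
  qed
  have Sup_nonneg: "0 \<le> Sup (A r)" for r
    by (rule cSup_upper[OF _ bdd]) (simp add: A_def)
  show ?thesis
  proof
    assume ?L
    show ?R
    proof (intro allI impI)
      fix \<epsilon> :: real
      assume "\<epsilon> > 0"
      then have "\<forall>\<^sub>F r in at_top. Sup (A r) < \<epsilon>"
        using \<open>?L\<close> by (simp add: flat order_tendstoD(2))
      then obtain r where r: "Sup (A r) < \<epsilon>"
        using eventually_happens'[OF trivial_limit_at_top_linorder] by blast
      have quotient: "a \<le> \<epsilon>" if "a \<in> A r" for a
        using cSup_upper[OF that bdd] r by simp
      have "\<bar>lip0_apply f x - lip0_apply f y\<bar> \<le> \<epsilon> * dist x y" if "r < dist 0 x" for x y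
      proof (cases "x = y")
        case False
        have "(lip0_apply f x - lip0_apply f y) / dist x y \<in> A r"
          "(lip0_apply f y - lip0_apply f x) / dist y x \<in> A r"
          using that False unfolding A_def by (force simp: not_le)+
        then have "(lip0_apply f x - lip0_apply f y) / dist x y \<le> \<epsilon>"
          "(lip0_apply f y - lip0_apply f x) / dist y x \<le> \<epsilon>"
          by (auto dest: quotient)
        then show ?thesis
          using False by (auto simp: divide_le_eq dist_commute abs_le_iff)
      qed simp
      then show "\<exists>r. \<forall>x y. r < dist 0 x \<longrightarrow> \<bar>lip0_apply f x - lip0_apply f y\<bar> \<le> \<epsilon> * dist x y"
        by blast
    qed
  next
    assume R: ?R
    show ?L
      unfolding flat
    proof (rule tendstoI)
      fix \<epsilon> :: real
      assume "\<epsilon> > 0"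
      then obtain \<rho> where \<rho>: "\<And>x y. \<rho> < dist 0 x \<Longrightarrow>
          \<bar>lip0_apply f x - lip0_apply f y\<bar> \<le> \<epsilon> / 2 * dist x y"
        using R half_gt_zero by blast
      have "Sup (A r) \<le> \<epsilon> / 2" if "r \<ge> \<rho>" for r
      proof (rule cSup_least)
        fix q
        assume "q \<in> A r"
        then consider "q = 0" | x y where "x \<noteq> y" "r < dist 0 x \<or> r < dist 0 y"
          "q = (lip0_apply f x - lip0_apply f y) / dist x y"
          by (auto simp: A_def not_le)
        then show "q \<le> \<epsilon> / 2"
        proof cases
          case 2
          then have "\<bar>lip0_apply f x - lip0_apply f y\<bar> \<le> \<epsilon> / 2 * dist x y"
            using \<rho>[of x y] \<rho>[of y x] that by (auto simp: dist_commute abs_minus_commute)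
          then have "lip0_apply f x - lip0_apply f y \<le> \<epsilon> / 2 * dist x y"
            by linarith
          with 2 show ?thesis
            by (simp add: divide_le_eq)
        qed (use \<open>\<epsilon> > 0\<close> in simp)
      qed (simp add: A_def)
      then show "\<forall>\<^sub>F r in at_top. dist (Sup (A r)) 0 < \<epsilon>"
        using Sup_nonneg \<open>\<epsilon> > 0\<close>
        by (intro eventually_at_top_linorderI[of \<rho>]) (force simp: dist_real_def)
    qed
  qed
qed

lemma uniformly_locally_flat_iff:
  "uniformly_locally_flat f \<longleftrightarrow>
    (\<forall>\<epsilon>>0. \<exists>\<delta>>0. \<forall>x y. dist x y < \<delta> \<longrightarrow> \<bar>f x - f y\<bar> \<le> \<epsilon> * dist x y)"
    (is "?L \<longleftrightarrow> ?R")
proof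
  assume L: ?L
  show ?R
  proof (intro allI impI)
    fix \<epsilon> :: real
    assume "\<epsilon> > 0"
    with L obtain \<delta> where "\<delta> > 0"
      "\<And>x y. x \<noteq> y \<Longrightarrow> dist x y < \<delta> \<Longrightarrow> \<bar>f x - f y\<bar> < \<epsilon> * dist x y"
      unfolding uniformly_locally_flat_def by metis
    then show "\<exists>\<delta>>0. \<forall>x y. dist x y < \<delta> \<longrightarrow> \<bar>f x - f y\<bar> \<le> \<epsilon> * dist x y"
      by (metis abs_zero cancel_comm_monoid_add_class.diff_cancel dist_eq_0_iff less_imp_le
          mult_zero_right order_refl)
  qed
next
  assume R: ?R
  show ?L
    unfolding uniformly_locally_flat_def
  proof (intro allI impI)
    fix \<epsilon> :: real
    assume "\<epsilon> > 0"
    with R obtain \<delta> where \<delta>: "\<delta> > 0"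
      "\<And>x y. dist x y < \<delta> \<Longrightarrow> \<bar>f x - f y\<bar> \<le> \<epsilon> / 2 * dist x y"
      using half_gt_zero by blast
    have "\<bar>f x - f y\<bar> < \<epsilon> * dist x y" if "x \<noteq> y \<and> dist x y < \<delta>" for x y
    proof -
      have "\<bar>f x - f y\<bar> \<le> \<epsilon> / 2 * dist x y"
        using \<delta>(2) that by blast
      moreover have "0 < \<epsilon> * dist x y"
        using that \<open>\<epsilon> > 0\<close> by simp
      ultimately show ?thesis
        by linarith
    qed
    with \<delta>(1) show "\<exists>\<delta>>0. \<forall>x y. x \<noteq> y \<and> dist x y < \<delta> \<longrightarrow> \<bar>f x - f y\<bar> < \<epsilon> * dist x y"
      by blast
  qed
qed

lemma lip0_uE:
  assumes "f \<in> lip0_u" "\<epsilon> > 0"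
  obtains \<delta> r where "\<delta> > 0"
    "\<And>x y. dist x y < \<delta> \<or> r < dist 0 x \<Longrightarrow>
      \<bar>lip0_apply f x - lip0_apply f y\<bar> \<le> \<epsilon> * dist x y"
proof -
  from assms obtain \<delta> where "\<delta> > 0"
    "\<forall>x y. dist x y < \<delta> \<longrightarrow> \<bar>lip0_apply f x - lip0_apply f y\<bar> \<le> \<epsilon> * dist x y"
    unfolding lip0_u_def uniformly_locally_flat_iff by blast
  moreover from assms obtain r where
    "\<forall>x y. r < dist 0 x \<longrightarrow> \<bar>lip0_apply f x - lip0_apply f y\<bar> \<le> \<epsilon> * dist x y"
    unfolding lip0_u_def flat_at_infinity_iff by blast
  ultimately show ?thesis
    using that by blast
qed

lemma lip0_uI:
  assumes "\<And>\<epsilon>. \<epsilon> > 0 \<Longrightarrow> \<exists>\<delta> r. \<delta> > 0 \<and>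
      (\<forall>x y. dist x y < \<delta> \<or> r < dist 0 x \<longrightarrow>
        \<bar>lip0_apply f x - lip0_apply f y\<bar> \<le> \<epsilon> * dist x y)"
  shows "f \<in> lip0_u"
  unfolding lip0_u_def mem_Collect_eq flat_at_infinity_iff uniformly_locally_flat_iff
  using assms by blast

lemma subspace_lip0_u: "subspace (lip0_u :: 'a::{metric_space, zero} lip0 set)"
proof (rule subspaceI)
  show "(0 :: 'a lip0) \<in> lip0_u"
    by (auto intro!: lip0_uI exI[of _ "1::real"])
  show "f + g \<in> lip0_u" if f: "f \<in> lip0_u" and g: "g \<in> lip0_u" for f g :: "'a lip0"
  proof (rule lip0_uI)
    fix \<epsilon> :: real
    assume "\<epsilon> > 0"
    then have "\<epsilon> / 2 > 0"
      by simp
    obtain \<delta> r where "\<delta> > 0" and *: "\<And>x y. dist x y < \<delta> \<or> r < dist 0 x \<Longrightarrow>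
        \<bar>lip0_apply f x - lip0_apply f y\<bar> \<le> \<epsilon> / 2 * dist x y"
      using lip0_uE[OF f \<open>\<epsilon> / 2 > 0\<close>] by blast
    obtain \<delta>' r' where "\<delta>' > 0" and **: "\<And>x y. dist x y < \<delta>' \<or> r' < dist 0 x \<Longrightarrow>
        \<bar>lip0_apply g x - lip0_apply g y\<bar> \<le> \<epsilon> / 2 * dist x y"
      using lip0_uE[OF g \<open>\<epsilon> / 2 > 0\<close>] by blast
    have "\<bar>lip0_apply (f + g) x - lip0_apply (f + g) y\<bar> \<le> \<epsilon> * dist x y"
      if "dist x y < min \<delta> \<delta>' \<or> max r r' < dist 0 x" for x y
    proof -
      have "\<bar>lip0_apply f x - lip0_apply f y\<bar> \<le> \<epsilon> / 2 * dist x y"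
        using * that by auto
      moreover have "\<bar>lip0_apply g x - lip0_apply g y\<bar> \<le> \<epsilon> / 2 * dist x y"
        using ** that by auto
      ultimately show ?thesis
        unfolding plus_lip0.rep_eq by linarith
    qed
    moreover have "min \<delta> \<delta>' > 0"
      using \<open>\<delta> > 0\<close> \<open>\<delta>' > 0\<close> by simp
    ultimately show "\<exists>\<delta> r. \<delta> > 0 \<and> (\<forall>x y. dist x y < \<delta> \<or> r < dist 0 x \<longrightarrow>
        \<bar>lip0_apply (f + g) x - lip0_apply (f + g) y\<bar> \<le> \<epsilon> * dist x y)"
      by blast
  qed
  show "c *\<^sub>R f \<in> lip0_u" if f: "f \<in> lip0_u" for c and f :: "'a lip0"
  proof (rule lip0_uI)
    fix \<epsilon> :: real
    assume "\<epsilon> > 0"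
    then have "\<epsilon> / (\<bar>c\<bar> + 1) > 0"
      by (simp add: add_nonneg_pos)
    from lip0_uE[OF f this] obtain \<delta> r where "\<delta> > 0"
      and *: "\<And>x y. dist x y < \<delta> \<or> r < dist 0 x \<Longrightarrow>
        \<bar>lip0_apply f x - lip0_apply f y\<bar> \<le> \<epsilon> / (\<bar>c\<bar> + 1) * dist x y"
      by blast
    have "\<bar>lip0_apply (c *\<^sub>R f) x - lip0_apply (c *\<^sub>R f) y\<bar> \<le> \<epsilon> * dist x y"
      if "dist x y < \<delta> \<or> r < dist 0 x" for x y
    proof -
      have "\<bar>lip0_apply (c *\<^sub>R f) x - lip0_apply (c *\<^sub>R f) y\<bar> =
          \<bar>c\<bar> * \<bar>lip0_apply f x - lip0_apply f y\<bar>"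
        by (simp add: abs_mult flip: right_diff_distrib)
      also have "\<dots> \<le> (\<bar>c\<bar> + 1) * (\<epsilon> / (\<bar>c\<bar> + 1) * dist x y)"
        using *[OF that] by (intro mult_mono) auto
      also have "\<dots> = \<epsilon> * dist x y"
        by simp
      finally show ?thesis .
    qed
    with \<open>\<delta> > 0\<close> show "\<exists>\<delta> r. \<delta> > 0 \<and> (\<forall>x y. dist x y < \<delta> \<or> r < dist 0 x \<longrightarrow>
        \<bar>lip0_apply (c *\<^sub>R f) x - lip0_apply (c *\<^sub>R f) y\<bar> \<le> \<epsilon> * dist x y)"
      by blast
  qed
qed

section \<open>Discretizations are flat and approximate flat functions\<close>

lemma mem_cball_cong:
  fixes x y z :: "'a::ultrametric_space"
  assumes "dist x y \<le> R"
  shows "dist z x \<le> R \<longleftrightarrow> dist z y \<le> R"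
  using ultrametric_le[of z x R y] ultrametric_le[of z y R x] assms by (auto simp: dist_commute)

lemma discretize_diff_le_radius:
  assumes "0 \<le> s" "0 \<le> R" "R < dist x y"
  shows "\<bar>lip0_apply (discretize s R f) x - lip0_apply (discretize s R f) y\<bar> \<le> norm f * R"
proof -
  have "\<not> (dist 0 x \<le> R \<and> dist 0 y \<le> R)"
    using ultrametric_le[of x 0 R y] assms(3) by (auto simp: dist_commute)
  moreover have "\<bar>lip0_apply f (ball_point s z)\<bar> \<le> norm f * R" if "dist 0 z \<le> R" for z
    using abs_apply_ball_point_le[OF assms(1), of f z] mult_left_mono[OF that, of "norm f"] by simp
  ultimately show ?thesis
    using assms by (auto simp: discretize_apply)
qed

lemma discretize_eq:
  assumes "0 \<le> s" "dist x y \<le> s" "dist x y \<le> R"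
  shows "lip0_apply (discretize s R f) x = lip0_apply (discretize s R f) y"
  using ball_point_cong[OF assms(2)] mem_cball_cong[OF assms(3), of 0]
  by (simp add: discretize_apply[OF assms(1)])

text \<open>The function is constant at scales below \<open>min s R\<close>. At a distance \<open>r > R\<close> from \<open>0\<close> it
  vanishes, so a nonzero difference involving such a point is at most \<open>norm f * R\<close>, over a distance of
  at least \<open>r\<close>.\<close>

lemma discretize_in_lip0_u:
  assumes "0 < s" "0 < R"
  shows "discretize s R f \<in> lip0_u"
proof (rule lip0_uI)
  fix \<epsilon> :: real
  assume "\<epsilon> > 0"
  define r where "r = max R (norm f * R / \<epsilon>)"
  have "\<bar>lip0_apply (discretize s R f) x - lip0_apply (discretize s R f) y\<bar> \<le> \<epsilon> * dist x y"
    if "dist x y < min s R \<or> r < dist 0 x" for x y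
    using that
  proof
    assume "dist x y < min s R"
    then have "lip0_apply (discretize s R f) x = lip0_apply (discretize s R f) y"
      using assms by (intro discretize_eq) auto
    then show ?thesis
      using \<open>\<epsilon> > 0\<close> by simp
  next
    assume far: "r < dist 0 x"
    then have x: "R < dist 0 x" and "norm f * R / \<epsilon> < dist 0 x"
      by (auto simp: r_def)
    then have far': "norm f * R \<le> \<epsilon> * dist 0 x"
      using \<open>\<epsilon> > 0\<close> by (simp add: divide_less_eq mult.commute)
    show ?thesis
    proof (cases "dist 0 y \<le> R")
      case True
      then have xy: "dist 0 x \<le> dist x y"
        using dist_across_ball[OF True x] by (simp add: dist_commute)
      then have "R < dist x y"
        using x by simp
      then have "\<bar>lip0_apply (discretize s R f) x - lip0_apply (discretize s R f) y\<bar> \<le> norm f * R"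
        using assms by (intro discretize_diff_le_radius) auto
      also have "\<dots> \<le> \<epsilon> * dist x y"
        using far' mult_left_mono[OF xy less_imp_le[OF \<open>\<epsilon> > 0\<close>]] by (rule order_trans)
      finally show ?thesis .
    next
      case False
      then show ?thesis
        using x assms \<open>\<epsilon> > 0\<close> by (simp add: discretize_apply)
    qed
  qed
  moreover have "min s R > 0"
    using assms by simp
  ultimately show "\<exists>\<delta> r. \<delta> > 0 \<and> (\<forall>x y. dist x y < \<delta> \<or> r < dist 0 x \<longrightarrow>
      \<bar>lip0_apply (discretize s R f) x - lip0_apply (discretize s R f) y\<bar> \<le> \<epsilon> * dist x y)"
    by blast
qed

text \<open>Below the scale \<open>s\<close>, the differences of \<open>discretize s R f - f\<close> are those of \<open>f\<close>, which local
  flatness controls. Above that scale, local flatness bounds the change of \<open>f\<close> at each of the two points by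
  \<open>\<epsilon> / 2\<close> times \<open>s\<close>. Outside the ball of radius \<open>R\<close>, where the difference is \<open>- f\<close>, flatness
  at infinity takes over; a pair across the boundary is compared with the pair of the outer point
  and \<open>0\<close>.\<close>

lemma discretize_approximates:
  fixes f :: "'a::{ultrametric_space, zero} lip0"
  assumes "f \<in> lip0_u" "\<epsilon> > 0"
  obtains \<delta> \<rho> where "\<delta> > 0"
    "\<And>s R. 0 \<le> s \<Longrightarrow> s < \<delta> \<Longrightarrow> \<rho> \<le> R \<Longrightarrow> norm (discretize s R f - f) \<le> \<epsilon>"
proof -
  let ?F = "lip0_apply f"
  have half: "\<epsilon> / 2 > 0"
    using assms(2) by simp
  obtain \<delta> \<rho> where "\<delta> > 0" and flat: "\<And>x y. dist x y < \<delta> \<or> \<rho> < dist 0 x \<Longrightarrow>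
      \<bar>?F x - ?F y\<bar> \<le> \<epsilon> / 2 * dist x y"
    using lip0_uE[OF assms(1) half] by blast
  have "norm (discretize s R f - f) \<le> \<epsilon>" if s: "0 \<le> s" "s < \<delta>" and R: "\<rho> \<le> R" for s R
  proof (rule lip0_norm_leI)
    let ?D = "discretize s R f"
    have move: "\<bar>?F (ball_point s x) - ?F x\<bar> \<le> \<epsilon> / 2 * dist x (ball_point s x)" for x
      using flat[of x "ball_point s x"] dist_ball_point[OF s(1), of x] s(2)
      by (simp add: abs_minus_commute)
    \<comment> \<open>With \<open>x\<close> the point nearer to \<open>0\<close>, only \<open>y\<close> can lie alone outside the ball.\<close>
    have one_sided: "\<bar>(lip0_apply ?D x - ?F x) - (lip0_apply ?D y - ?F y)\<bar> \<le> \<epsilon> * dist x y"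
      if le: "dist 0 x \<le> dist 0 y" for x y
    proof (cases "dist 0 y \<le> R")
      case True
      have D: "lip0_apply ?D x = ?F (ball_point s x)" "lip0_apply ?D y = ?F (ball_point s y)"
        using True le s(1) by (simp_all add: discretize_apply)
      show ?thesis
      proof (cases "dist x y \<le> s")
        case True
        have "\<bar>?F x - ?F y\<bar> \<le> \<epsilon> / 2 * dist x y"
          using True s(2) by (intro flat) simp
        moreover have "0 \<le> \<epsilon> / 2 * dist x y"
          using half by simp
        ultimately show ?thesis
          unfolding D ball_point_cong[OF True] by linarith
      next
        case False
        have "\<bar>?F (ball_point s z) - ?F z\<bar> \<le> \<epsilon> / 2 * dist x y" for z
        proof -
          have "dist z (ball_point s z) \<le> dist x y"
            using dist_ball_point[OF s(1), of z] False by simp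
          then have "\<epsilon> / 2 * dist z (ball_point s z) \<le> \<epsilon> / 2 * dist x y"
            using half by (intro mult_left_mono) auto
          with move[of z] show ?thesis
            by (rule order_trans)
        qed
        from this[of x] this[of y] show ?thesis
          unfolding D by linarith
      qed
    next
      case y: False
      have Dy: "lip0_apply ?D y = 0"
        using y s(1) by (simp add: discretize_apply)
      show ?thesis
      proof (cases "dist 0 x \<le> R")
        case True
        have xy: "dist 0 y \<le> dist x y"
          using dist_across_ball[OF True, of y] y by simp
        \<comment> \<open>Here \<open>s\<close> may exceed \<open>dist x y\<close>, but \<open>ball_point\<close> does not move \<open>x\<close> away from \<open>0\<close>.\<close>
        have "dist x (ball_point s x) \<le> dist 0 x"
          using ultrametric_le[of x 0 "dist 0 x" "ball_point s x"]
            dist_ball_point_le[OF s(1), of 0 x] s(1) by (simp add: dist_commute)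
        then have "dist x (ball_point s x) \<le> dist x y"
          using le xy by simp
        then have "\<epsilon> / 2 * dist x (ball_point s x) \<le> \<epsilon> / 2 * dist x y"
          using half by (intro mult_left_mono) auto
        then have "\<bar>lip0_apply ?D x - ?F x\<bar> \<le> \<epsilon> / 2 * dist x y"
          using move[of x] True s(1) by (simp add: discretize_apply)
        moreover have "\<bar>?F y - ?F 0\<bar> \<le> \<epsilon> / 2 * dist y 0"
          using y R by (intro flat) simp
        then have "\<bar>?F y\<bar> \<le> \<epsilon> / 2 * dist x y"
          using mult_left_mono[OF xy less_imp_le[OF half]]
          unfolding lip0_apply_zero dist_commute[of y 0] by linarith
        ultimately show ?thesis
          unfolding Dy by linarith
      next
        case False
        then have "\<bar>?F x - ?F y\<bar> \<le> \<epsilon> / 2 * dist x y"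
          using R by (intro flat) simp
        moreover have "0 \<le> \<epsilon> / 2 * dist x y"
          using half by simp
        moreover have "lip0_apply ?D x = 0"
          using False s(1) by (simp add: discretize_apply)
        ultimately show ?thesis
          unfolding Dy by linarith
      qed
    qed
    show "\<bar>lip0_apply (?D - f) x - lip0_apply (?D - f) y\<bar> \<le> \<epsilon> * dist x y" for x y
      using one_sided[of x y] one_sided[of y x] linear[of "dist 0 x" "dist 0 y"]
      by (auto simp only: minus_lip0.rep_eq dist_commute[of y x]
          abs_minus_commute[of "lip0_apply ?D y - ?F y"])
  qed (use assms in simp)
  with \<open>\<delta> > 0\<close> show ?thesis
    using that by blast
qed

section \<open>Gluing at a single pair of scales\<close>

text \<open>Let \<open>t\<close> be the distance of \<open>x\<close> and \<open>y\<close>. The difference of values disappears, at least up to a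
  small error, if \<open>t\<close> is at most \<open>s\<close>, if both points are outside the ball of radius \<open>R\<close>, or if \<open>t\<close> is
  far larger than \<open>R\<close>. In the remaining case both points are in the ball and move by at most
  \<open>\<eta> * t\<close>, so that the difference nearly survives. The factor \<open>c\<close> depends on the pair only, not on \<open>f\<close>: the gluing estimate needs the same \<open>c\<close> for two
  functions.\<close>

lemma discretize_keeps_or_kills:
  fixes x y :: "'a::{ultrametric_space, zero}"
  assumes "0 < s" "0 < R" "0 \<le> \<eta>"
    and s: "dist x y \<le> s \<or> s \<le> \<eta> * dist x y"
    and R: "dist x y \<le> R \<or> R \<le> \<eta> * dist x y"
  obtains c :: real where "c = 0 \<or> c = 1"
    "\<And>f. \<bar>lip0_apply (discretize s R f) x - lip0_apply (discretize s R f) y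
        - c * (lip0_apply f x - lip0_apply f y)\<bar> \<le> 2 * \<eta> * norm f * dist x y"
proof -
  have nn: "0 \<le> 2 * \<eta> * norm f * dist x y" for f :: "'a lip0"
    using assms(3) by simp
  consider "dist x y \<le> s" "dist x y \<le> R" | "R < dist x y" "R \<le> \<eta> * dist x y"
    | "s < dist x y" "s \<le> \<eta> * dist x y" "dist x y \<le> R"
    using s R by linarith
  then show ?thesis
  proof cases
    case 1
    then show ?thesis
      using that[of 0] discretize_eq[of s x y R] assms(1) nn by simp
  next
    case 2
    have "\<bar>lip0_apply (discretize s R f) x - lip0_apply (discretize s R f) y\<bar>
        \<le> 2 * \<eta> * norm f * dist x y" for f
    proof -
      have "\<bar>lip0_apply (discretize s R f) x - lip0_apply (discretize s R f) y\<bar> \<le> norm f * R"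
        using 2 assms by (intro discretize_diff_le_radius) auto
      also have "\<dots> \<le> norm f * (\<eta> * dist x y)"
        using 2 by (intro mult_left_mono) auto
      also have "\<dots> \<le> 2 * \<eta> * norm f * dist x y"
        using nn[of f] by (simp add: mult_ac)
      finally show ?thesis .
    qed
    then show ?thesis
      using that[of 0] by simp
  next
    case 3
    have in_ball: "dist 0 x \<le> R \<longleftrightarrow> dist 0 y \<le> R"
      by (rule mem_cball_cong[OF 3(3)])
    have move: "\<bar>lip0_apply f (ball_point s z) - lip0_apply f z\<bar> \<le> \<eta> * norm f * dist x y" for f z
    proof -
      have "\<bar>lip0_apply f (ball_point s z) - lip0_apply f z\<bar> \<le> norm f * dist (ball_point s z) z"
        by (rule lip0_norm_bound)
      also have "\<dots> \<le> norm f * (\<eta> * dist x y)"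
        using dist_ball_point[of s z] assms(1) 3(2)
        by (intro mult_left_mono) (auto simp: dist_commute)
      finally show ?thesis
        by (simp add: mult_ac)
    qed
    have "\<bar>lip0_apply f (ball_point s x) - lip0_apply f (ball_point s y)
        - (lip0_apply f x - lip0_apply f y)\<bar> \<le> 2 * \<eta> * norm f * dist x y" for f
      using move[of f x] move[of f y] unfolding mult.assoc by linarith
    then show ?thesis
      using that[of "if dist 0 x \<le> R then 1 else 0"] in_ball assms(1) nn
      by (auto simp: discretize_apply split: if_splits)
  qed
qed

text \<open>With the common factor \<open>c\<close> from the dichotomy, the difference of \<open>h\<close> is close to
  \<open>c * \<Delta> f + (1 - c) * \<Delta> g\<close>, that is, to the difference of one of the two functions.\<close>

lemma discretize_glue:
  fixes x y :: "'a::{ultrametric_space, zero}" and f g :: "'a lip0"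
  assumes "0 < s" "0 < R" "0 \<le> \<eta>"
    and "dist x y \<le> s \<or> s \<le> \<eta> * dist x y"
    and "dist x y \<le> R \<or> R \<le> \<eta> * dist x y"
  defines "h \<equiv> discretize s R f + (g - discretize s R g)"
  shows "\<bar>lip0_apply h x - lip0_apply h y\<bar> \<le> (1 + 4 * \<eta>) * (max (norm f) (norm g) * dist x y)"
proof -
  define m where "m = max (norm f) (norm g)"
  define \<Delta> where "\<Delta> u = lip0_apply u x - lip0_apply u y" for u :: "'a lip0"
  obtain c :: real where c: "c = 0 \<or> c = 1"
    and D: "\<And>u. \<bar>\<Delta> (discretize s R u) - c * \<Delta> u\<bar> \<le> 2 * \<eta> * norm u * dist x y"
    unfolding \<Delta>_def using discretize_keeps_or_kills[OF assms(1-5)] by metis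
  have "\<bar>\<Delta> u\<bar> \<le> m * dist x y \<and> \<bar>\<Delta> (discretize s R u) - c * \<Delta> u\<bar> \<le> 2 * (\<eta> * (m * dist x y))"
    if "norm u \<le> m" for u
  proof
    show "\<bar>\<Delta> u\<bar> \<le> m * dist x y"
      unfolding \<Delta>_def using lip0_norm_bound[of u x y] mult_right_mono[OF that, of "dist x y"] by simp
    have "2 * \<eta> * norm u * dist x y \<le> 2 * \<eta> * m * dist x y"
      using that assms(3) by (intro mult_right_mono mult_left_mono) auto
    then show "\<bar>\<Delta> (discretize s R u) - c * \<Delta> u\<bar> \<le> 2 * (\<eta> * (m * dist x y))"
      using D[of u] by (simp add: mult_ac)
  qed
  from this[of f] this[of g]
  have "\<bar>\<Delta> f\<bar> \<le> m * dist x y" "\<bar>\<Delta> g\<bar> \<le> m * dist x y"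
    "\<bar>\<Delta> (discretize s R f) - c * \<Delta> f\<bar> \<le> 2 * (\<eta> * (m * dist x y))"
    "\<bar>\<Delta> (discretize s R g) - c * \<Delta> g\<bar> \<le> 2 * (\<eta> * (m * dist x y))"
    by (auto simp: m_def)
  moreover have "\<Delta> h = \<Delta> (discretize s R f) + (\<Delta> g - \<Delta> (discretize s R g))"
    by (simp add: h_def \<Delta>_def)
  ultimately have "\<bar>\<Delta> h\<bar> \<le> m * dist x y + 4 * (\<eta> * (m * dist x y))"
    using c by auto
  then show ?thesis
    by (simp add: \<Delta>_def m_def algebra_simps)
qed

lemma discretize_glue_crude:
  fixes f g :: "'a::{ultrametric_space, zero} lip0" and R :: real
  assumes "0 \<le> s"
  defines "h \<equiv> discretize s R f + (g - discretize s R g)"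
  shows "\<bar>lip0_apply h x - lip0_apply h y\<bar> \<le> 3 * (max (norm f) (norm g) * dist x y)"
proof -
  define B where "B = max (norm f) (norm g) * dist x y"
  have "norm f * dist x y \<le> B" "norm g * dist x y \<le> B"
    unfolding B_def by (auto intro: mult_right_mono)
  moreover have "lip0_apply h x - lip0_apply h y =
      (lip0_apply (discretize s R f) x - lip0_apply (discretize s R f) y)
      + (lip0_apply g x - lip0_apply g y)
      - (lip0_apply (discretize s R g) x - lip0_apply (discretize s R g) y)"
    by (simp add: h_def)
  ultimately show ?thesis
    using discretize_diff_le[OF assms(1), of R f x y] discretize_diff_le[OF assms(1), of R g x y]
      lip0_norm_bound[of g x y] unfolding B_def[symmetric] by linarith
qed

section \<open>Averaging over many scales\<close>

text \<open>All the scales \<open>\<eta> ^ k\<close> and \<open>(1 / \<eta>) ^ k\<close> with \<open>k \<ge> 1\<close> are powers of \<open>\<eta>\<close> with different integer exponents, so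
  any two of them differ by a factor of at least \<open>1 / \<eta>\<close>, while two numbers strictly between \<open>\<eta> * t\<close>
  and \<open>t\<close> differ by a smaller factor.\<close>

lemma at_most_one_scale_in_gap:
  fixes \<eta> t :: real and i j :: nat
  assumes \<eta>: "0 < \<eta>" "\<eta> \<le> 1"
    and "1 \<le> i" "i < j"
    and i: "\<eta> * t < \<eta> ^ i \<and> \<eta> ^ i < t \<or> \<eta> * t < (1 / \<eta>) ^ i \<and> (1 / \<eta>) ^ i < t"
    and j: "\<eta> * t < \<eta> ^ j \<and> \<eta> ^ j < t \<or> \<eta> * t < (1 / \<eta>) ^ j \<and> (1 / \<eta>) ^ j < t"
  shows False
proof -
  have close: "\<not> (\<eta> * t < a \<and> b < t \<and> a \<le> \<eta> * b)" for a b
    using mult_strict_left_mono[of b t \<eta>] \<eta>(1) by linarith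
  have small: "\<eta> ^ k \<le> \<eta>" if "1 \<le> k" for k
    using power_decreasing[OF that, of \<eta>] \<eta> by simp
  have large: "1 \<le> (1 / \<eta>) ^ k" for k
    using \<eta> by (intro one_le_power) simp
  have "\<eta> ^ j \<le> \<eta> * \<eta> ^ i"
    using power_decreasing[of "Suc i" j \<eta>] assms by simp
  moreover have "(1 / \<eta>) ^ i \<le> \<eta> * (1 / \<eta>) ^ j"
    using power_increasing[of "Suc i" j "1 / \<eta>"] assms by (simp add: field_simps)
  moreover have "\<eta> ^ a \<le> \<eta> * (1 / \<eta>) ^ b" if "1 \<le> a" for a b
    using small[OF that] mult_left_mono[OF large[of b] less_imp_le[OF \<eta>(1)]] by linarith
  ultimately show False
    using i j close assms(3,4) by (meson less_imp_le order_trans)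
qed

lemma sum_le_all_but_one:
  fixes b :: "nat \<Rightarrow> real"
  assumes "finite A" "0 \<le> C"
    and good: "\<And>i. i \<in> A \<Longrightarrow> \<not> bad i \<Longrightarrow> b i \<le> B"
    and bad: "\<And>i. i \<in> A \<Longrightarrow> bad i \<Longrightarrow> b i \<le> B + C"
    and unique: "\<And>i j. i \<in> A \<Longrightarrow> j \<in> A \<Longrightarrow> bad i \<Longrightarrow> bad j \<Longrightarrow> i = j"
  shows "sum b A \<le> real (card A) * B + C"
proof -
  have "card {i \<in> A. bad i} \<le> 1"
    using unique by (auto simp: card_le_Suc0_iff_eq assms(1))
  have "sum b A \<le> (\<Sum>i\<in>A. B + (if bad i then C else 0))"
    using good bad by (intro sum_mono) auto
  also have "\<dots> = real (card A) * B + real (card {i \<in> A. bad i}) * C"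
    using assms(1) by (simp add: sum.distrib sum.inter_filter[symmetric])
  also have "\<dots> \<le> real (card A) * B + 1 * C"
    using \<open>card {i \<in> A. bad i} \<le> 1\<close> assms(2) by (intro add_left_mono mult_right_mono) auto
  finally show ?thesis
    by simp
qed

text \<open>A single discretization handles badly the pairs of points whose distance is slightly larger than
  \<open>s\<close> or \<open>R\<close>. In this average over \<open>N\<close> well separated pairs of scales, each pair of points is bad for
  at most one summand. For \<open>N > 0\<close>, all fine scales are at most \<open>1 / N\<close> and all coarse ones at
  least \<open>N\<close>.\<close>

definition multiscale :: "nat \<Rightarrow> 'a::{ultrametric_space, zero} lip0 \<Rightarrow> 'a lip0" where
  "multiscale N f =
    (1 / real N) *\<^sub>R (\<Sum>k\<in>{1..N}. discretize ((1 / real N) ^ k) (real N ^ k) f)"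

lemma linear_multiscale: "linear (multiscale N)"
  unfolding multiscale_def
  by (intro linear_compose_scale_right linear_compose_sum ballI linear_discretize) simp

lemma multiscale_in_lip0_u: "multiscale N f \<in> lip0_u"
proof (cases "N = 0")
  case True
  then show ?thesis
    using subspace_0[OF subspace_lip0_u] by (simp add: multiscale_def)
next
  case False
  then show ?thesis
    unfolding multiscale_def
    by (intro subspace_scale[OF subspace_lip0_u] subspace_sum[OF subspace_lip0_u]
        discretize_in_lip0_u) auto
qed

lemma lip0_apply_sum: "lip0_apply (sum F A) x = (\<Sum>i\<in>A. lip0_apply (F i) x)"
  by (induction A rule: infinite_finite_induct) auto

text \<open>The relative gap is \<open>\<eta> = 1 / N\<close>. The good scales contribute an error \<open>4 * \<eta>\<close>, and a bad one costs
  at most \<open>3\<close> instead of \<open>1 + 4 * \<eta>\<close>, an excess of at most \<open>2\<close>, which the average divides by \<open>N\<close>.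
  Together this is \<open>6 / N\<close>.\<close>

lemma multiscale_glue:
  fixes f g :: "'a::{ultrametric_space, zero} lip0"
  assumes "0 < N"
  shows "norm (multiscale N f + (g - multiscale N g)) \<le> (1 + 6 / real N) * max (norm f) (norm g)"
proof (rule lip0_norm_leI)
  fix x y :: 'a
  define m where "m = max (norm f) (norm g) * dist x y"
  define \<eta> where "\<eta> = 1 / real N"
  define s where "s k = \<eta> ^ k" for k :: nat
  define R where "R k = (1 / \<eta>) ^ k" for k :: nat
  define h where "h k = discretize (s k) (R k) f + (g - discretize (s k) (R k) g)" for k
  define bad where "bad k \<longleftrightarrow> \<eta> * dist x y < s k \<and> s k < dist x y
      \<or> \<eta> * dist x y < R k \<and> R k < dist x y" for k
  have \<eta>: "0 < \<eta>" "\<eta> \<le> 1" and m: "0 \<le> m"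
    using assms by (auto simp: \<eta>_def m_def le_max_iff_disj)
  have pos: "0 < s k" "0 < R k" for k
    using \<eta> by (auto simp: s_def R_def)
  have average: "multiscale N f + (g - multiscale N g) = \<eta> *\<^sub>R (\<Sum>k\<in>{1..N}. h k)"
    using assms
    by (simp add: multiscale_def h_def s_def R_def \<eta>_def sum.distrib sum_subtractf
        scaleR_add_right scaleR_diff_right sum_constant_scaleR)
  have "(\<Sum>k\<in>{1..N}. \<bar>lip0_apply (h k) x - lip0_apply (h k) y\<bar>)
      \<le> real (card {1..N}) * ((1 + 4 * \<eta>) * m) + 2 * m"
  proof (rule sum_le_all_but_one[where bad = bad])
    show "\<bar>lip0_apply (h k) x - lip0_apply (h k) y\<bar> \<le> (1 + 4 * \<eta>) * m" if "\<not> bad k" for k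
      using that \<eta>(1) pos[of k] unfolding h_def m_def bad_def
      by (intro discretize_glue) (auto simp: not_less)
    show "\<bar>lip0_apply (h k) x - lip0_apply (h k) y\<bar> \<le> (1 + 4 * \<eta>) * m + 2 * m" for k
    proof -
      have "\<bar>lip0_apply (h k) x - lip0_apply (h k) y\<bar> \<le> 3 * m"
        using pos(1)[of k] unfolding h_def m_def by (intro discretize_glue_crude) simp
      also have "3 * m \<le> (1 + 4 * \<eta>) * m + 2 * m"
        using m \<eta>(1) by (simp add: algebra_simps)
      finally show ?thesis .
    qed
    show "i = j" if "i \<in> {1..N}" "j \<in> {1..N}" "bad i" "bad j" for i j
      using at_most_one_scale_in_gap[OF \<eta>, of i j "dist x y"]
        at_most_one_scale_in_gap[OF \<eta>, of j i "dist x y"] that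
      unfolding bad_def s_def R_def by (metis atLeastAtMost_iff nat_neq_iff)
  qed (use m in auto)
  then have sum_le: "(\<Sum>k\<in>{1..N}. \<bar>lip0_apply (h k) x - lip0_apply (h k) y\<bar>)
      \<le> real N * ((1 + 4 * \<eta>) * m) + 2 * m"
    by simp
  have "\<bar>\<Sum>k\<in>{1..N}. lip0_apply (h k) x - lip0_apply (h k) y\<bar>
      \<le> real N * ((1 + 4 * \<eta>) * m) + 2 * m"
    using sum_abs sum_le by (rule order_trans)
  then have "\<eta> * \<bar>\<Sum>k\<in>{1..N}. lip0_apply (h k) x - lip0_apply (h k) y\<bar>
      \<le> \<eta> * (real N * ((1 + 4 * \<eta>) * m) + 2 * m)"
    using \<eta>(1) by (intro mult_left_mono) auto
  also have "\<dots> = (1 + 6 / real N) * max (norm f) (norm g) * dist x y"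
    using assms by (simp add: \<eta>_def m_def field_simps)
  finally show "\<bar>lip0_apply (multiscale N f + (g - multiscale N g)) x
      - lip0_apply (multiscale N f + (g - multiscale N g)) y\<bar>
      \<le> (1 + 6 / real N) * max (norm f) (norm g) * dist x y"
    using \<eta>(1)
    by (simp add: average lip0_apply_sum sum_subtractf abs_mult flip: right_diff_distrib)
qed (simp add: le_max_iff_disj)

lemma multiscale_tendsto:
  fixes f :: "'a::{ultrametric_space, zero} lip0"
  assumes "f \<in> lip0_u"
  shows "(\<lambda>n. multiscale (Suc n) f) \<longlonglongrightarrow> f"
proof (rule tendstoI)
  fix \<epsilon> :: real
  assume "\<epsilon> > 0"
  then have half: "\<epsilon> / 2 > 0"
    by simp
  obtain \<delta> \<rho> where "\<delta> > 0"
    and approx: "\<And>s R. 0 \<le> s \<Longrightarrow> s < \<delta> \<Longrightarrow> \<rho> \<le> R \<Longrightarrow> norm (discretize s R f - f) \<le> \<epsilon> / 2"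
    using discretize_approximates[OF assms half] by blast
  have "\<forall>\<^sub>F n in sequentially. 1 / real (Suc n) < \<delta>"
    using \<open>\<delta> > 0\<close> LIMSEQ_Suc[OF lim_1_over_n] order_tendstoD(2) by blast
  moreover have "\<forall>\<^sub>F n in sequentially. \<rho> \<le> real (Suc n)"
    by (rule eventually_sequentiallyI[of "nat \<lceil>\<rho>\<rceil>"]) linarith
  ultimately show "\<forall>\<^sub>F n in sequentially. dist (multiscale (Suc n) f) f < \<epsilon>"
  proof eventually_elim
    case (elim n)
    define N where "N = Suc n"
    define D where "D k = discretize ((1 / real N) ^ k) (real N ^ k) f" for k
    have "norm (D k - f) \<le> \<epsilon> / 2" if "k \<in> {1..N}" for k
      unfolding D_def
    proof (rule approx)
      have "(1 / real N) ^ k \<le> (1 / real N) ^ 1"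
        using that by (intro power_decreasing) (auto simp: N_def)
      then show "(1 / real N) ^ k < \<delta>"
        using elim(1) by (simp add: N_def)
      have "real N ^ 1 \<le> real N ^ k"
        using that by (intro power_increasing) (auto simp: N_def)
      then show "\<rho> \<le> real N ^ k"
        using elim(2) by (simp add: N_def)
    qed simp
    then have "norm (\<Sum>k\<in>{1..N}. D k - f) \<le> real N * (\<epsilon> / 2)"
      using sum_norm_bound[of "{1..N}" "\<lambda>k. D k - f" "\<epsilon> / 2"] by simp
    moreover have "N > 0"
      by (simp add: N_def)
    moreover from this have "multiscale N f - f = (1 / real N) *\<^sub>R (\<Sum>k\<in>{1..N}. D k - f)"
      by (simp add: multiscale_def D_def sum_subtractf scaleR_diff_right sum_constant_scaleR)
    ultimately have "norm (multiscale N f - f) \<le> \<epsilon> / 2"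
      by (simp add: divide_le_eq mult.commute)
    then show ?case
      using \<open>\<epsilon> > 0\<close> by (simp add: dist_norm N_def)
  qed
qed

theorem proposition4p12:
  shows "M_ideal (lip0_u :: 'a::{ultrametric_space, zero} lip0 set)"
proof (rule M_ideal_if_approximate_projections)
  show "(\<lambda>n. 6 / real (Suc n)) \<longlonglongrightarrow> 0"
    using tendsto_mult_right_zero[OF LIMSEQ_Suc[OF lim_1_over_n], of 6] by simp
qed (use subspace_lip0_u linear_multiscale multiscale_in_lip0_u multiscale_tendsto
    multiscale_glue[OF zero_less_Suc] in auto)

end
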